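(* Let $n\in\mathbb{N}^*$ and $m,s,t,l\in\mathbb{N}$ with $l\ge m\ge s$ and $l\ge t+m$. Then the following hold. (i) If $m=1$, or $m=s+1$, or $l=t+1$, then the independence polynomial of $\mathcal{F}_n(l,m,t,s)$ is log-concave. (ii) If $l\ge 1$ and $t=0$, then the independence polynomial of $\mathcal{F}_n(l,m,t,s)$ is log-concave.
   Context: $\mathbb{N}=\{0,1,2,\dots\}$ and $\mathbb{N}^*=\{1,2,\dots\}$. $K_r$ is the complete graph on $r$ vertices ($K_0$ is the empty graph). The independence polynomial of a graph $G$ is $I(G;x)=\sum_{k=0}^{\alpha(G)} i_k(G)x^k$, where $i_k(G)$ is the number of independent sets of size $k$ in $G$ ($i_0(G)=1$) and $\alpha(G)$ is the maximum size of an independent set. It is log-concave if $i_{k-1}(G)\,i_{k+1}(G)\le i_k(G)^2$ for all $1\le k\le \alpha(G)-1$. The graph $\mathcal{F}(l,m,t,s)$ (for $l\ge m\ge s$, $l\ge t+m$): take a vertex $c$ (the center), a vertex $x_i$, and vertex-disjoint complete graphs $K_m$, $K_l$, $K_{m-s}$, $K_{l-t}$. Join $c$ to $x_i$ by an edge; join $c$ to $s$ vertices of $K_m$, to $t$ vertices of $K_l$, to all $m-s$ vertices of $K_{m-s}$, and to $l-t-m$ vertices of $K_{l-t}$; join $x_i$ to all $m$ vertices of $K_m$ and to $l-m$ vertices of $K_l$. There are no other edges. The vertices of the complete graphs to which $c$ and $x_i$ are joined may be chosen arbitrarily; the result holds for every such choice. The graph $\mathcal{F}_n(l,m,t,s)$: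 take $n$ disjoint copies of $\mathcal{F}(l,m,t,s)$, with the vertices $x_i$ of the copies named $x_1,\dots,x_n$, and identify the vertices $c$ of all the copies into a single vertex $c$. *)

theory Defs
  imports Main "HOL-Computational_Algebra.Polynomial"
begin

text \<open>Edges are the two-element sets of adjacent vertices.\<close>

record 'a sgraph =
  verts :: "'a set"
  edges :: "'a set set"

definition finite_simple_graph :: "'a sgraph \<Rightarrow> bool" where
  "finite_simple_graph G \<longleftrightarrow>
     finite (verts G) \<and> (\<forall>e\<in>edges G. e \<subseteq> verts G \<and> card e = 2)"

definition indep_set :: "'a sgraph \<Rightarrow> 'a set \<Rightarrow> bool" where
  "indep_set G S \<longleftrightarrow> S \<subseteq> verts G \<and> (\<forall>u\<in>S. \<forall>v\<in>S. {u, v} \<notin> edges G)"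

definition indep_count :: "'a sgraph \<Rightarrow> nat \<Rightarrow> nat" where
  "indep_count G k = card {S. indep_set G S \<and> card S = k}"

definition indep_number :: "'a sgraph \<Rightarrow> nat" where
  "indep_number G = Max (card ` {S. indep_set G S})"

definition indep_poly :: "'a sgraph \<Rightarrow> int poly" where
  "indep_poly G = (\<Sum>k = 0..indep_number G. monom (int (indep_count G k)) k)"

text \<open>The interval below is empty for independence number 0 or 1, despite truncated subtraction.\<close>

definition indep_poly_log_concave :: "'a sgraph \<Rightarrow> bool" where
  "indep_poly_log_concave G \<longleftrightarrow>
     (\<forall>k\<in>{1..indep_number G - 1}.
        coeff (indep_poly G) (k - 1) * coeff (indep_poly G) (k + 1) \<le> (coeff (indep_poly G) k)\<^sup>2)"

lemma coeff_indep_poly: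
  "coeff (indep_poly G) k = (if k \<le> indep_number G then int (indep_count G k) else 0)"
  by (simp add: indep_poly_def coeff_sum)

definition complete_edges :: "'a set \<Rightarrow> 'a set set" where
  "complete_edges A = {{u, v} |u v. u \<in> A \<and> v \<in> A \<and> u \<noteq> v}"

definition join_edges :: "'a \<Rightarrow> 'a set \<Rightarrow> 'a set set" where
  "join_edges u B = {{u, v} |v. v \<in> B}"

text \<open>
  The center \<open>c\<close>, the vertex \<open>x\<^sub>i\<close>, and the vertices of the complete graphs
  \<open>K\<^sub>m\<close>, \<open>K\<^sub>l\<close>, \<open>K\<^bsub>m-s\<^esub>\<close>, \<open>K\<^bsub>l-t\<^esub>\<close>. The four constructors keep these
  complete graphs disjoint even when their orders coincide.
\<close>

datatype fvertex = Center | X | Km nat | Kl nat | Kms nat | Klt nat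

text \<open>
  In \<open>F_graph l m t s P Q R Y\<close>, the center is joined to the vertices of \<open>K\<^sub>m\<close>, \<open>K\<^sub>l\<close> and
  \<open>K\<^bsub>l-t\<^esub>\<close> with indices in \<open>P\<close>, \<open>Q\<close> and \<open>R\<close> respectively, and \<open>x\<^sub>i\<close> is joined to the
  vertices of \<open>K\<^sub>l\<close> with indices in \<open>Y\<close>.
\<close>

definition F_graph ::
  "nat \<Rightarrow> nat \<Rightarrow> nat \<Rightarrow> nat \<Rightarrow> nat set \<Rightarrow> nat set \<Rightarrow> nat set \<Rightarrow> nat set \<Rightarrow> fvertex sgraph" where
  "F_graph l m t s P Q R Y =
     \<lparr>verts = {Center, X} \<union> Km ` {..<m} \<union> Kl ` {..<l} \<union> Kms ` {..<m - s} \<union> Klt ` {..<l - t},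
      edges = complete_edges (Km ` {..<m}) \<union> complete_edges (Kl ` {..<l})
        \<union> complete_edges (Kms ` {..<m - s}) \<union> complete_edges (Klt ` {..<l - t})
        \<union> join_edges Center ({X} \<union> Km ` P \<union> Kl ` Q \<union> Kms ` {..<m - s} \<union> Klt ` R)
        \<union> join_edges X (Km ` {..<m} \<union> Kl ` Y)\<rparr>"

text \<open>All graphs \<open>\<F>(l,m,t,s)\<close>, one for each choice of the vertices joined to \<open>c\<close> and \<open>x\<^sub>i\<close>.\<close>

definition F_graphs :: "nat \<Rightarrow> nat \<Rightarrow> nat \<Rightarrow> nat \<Rightarrow> fvertex sgraph set" where
  "F_graphs l m t s =
     {F_graph l m t s P Q R Y |P Q R Y.
        P \<subseteq> {..<m} \<and> card P = s \<and>
        Q \<subseteq> {..<l} \<and> card Q = t \<and>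
        R \<subseteq> {..<l - t} \<and> card R = l - t - m \<and>
        Y \<subseteq> {..<l} \<and> card Y = l - m}"

text \<open>
  Vertex \<open>v\<close> of the \<open>i\<close>-th copy becomes \<open>Some (i, v)\<close>; the centers of all copies
  are identified with the single vertex \<open>None\<close>.
\<close>

definition copy_vertex :: "nat \<Rightarrow> fvertex \<Rightarrow> (nat \<times> fvertex) option" where
  "copy_vertex i v = (if v = Center then None else Some (i, v))"

definition glue_at_center :: "nat \<Rightarrow> (nat \<Rightarrow> fvertex sgraph) \<Rightarrow> (nat \<times> fvertex) option sgraph" where
  "glue_at_center n G =
     \<lparr>verts = (\<Union>i\<in>{1..n}. copy_vertex i ` verts (G i)),
      edges = (\<Union>i\<in>{1..n}. (\<lambda>e. copy_vertex i ` e) ` edges (G i))\<rparr>"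

text \<open>
  All graphs \<open>\<F>\<^sub>n(l,m,t,s)\<close>. The joined vertices may be chosen independently in each copy;
  taking \<open>G\<close> constant gives \<open>n\<close> copies of one and the same graph.
\<close>

definition Fn_graphs ::
  "nat \<Rightarrow> nat \<Rightarrow> nat \<Rightarrow> nat \<Rightarrow> nat \<Rightarrow> (nat \<times> fvertex) option sgraph set" where
  "Fn_graphs n l m t s =
     {glue_at_center n G |G. \<forall>i\<in>{1..n}. G i \<in> F_graphs l m t s}"

lemma finite_simple_graph_F_graphs:
  assumes "G \<in> F_graphs l m t s"
  shows "finite_simple_graph G"
proof -
  from assms obtain P Q R Y where G: "G = F_graph l m t s P Q R Y"
    and sub: "P \<subseteq> {..<m}" "Q \<subseteq> {..<l}" "R \<subseteq> {..<l - t}" "Y \<subseteq> {..<l}"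
    unfolding F_graphs_def by blast
  have complete: "e \<subseteq> A \<and> card e = 2" if "e \<in> complete_edges A" for e and A :: "fvertex set"
    using that by (auto simp: complete_edges_def)
  have join: "e \<subseteq> insert u B \<and> card e = 2"
    if "e \<in> join_edges u B" "u \<notin> B" for e u and B :: "fvertex set"
    using that by (auto simp: join_edges_def card_insert_if)
  let ?N = "{X} \<union> Km ` P \<union> Kl ` Q \<union> Kms ` {..<m - s} \<union> Klt ` R"
  let ?M = "Km ` {..<m} \<union> Kl ` Y"
  have V: "insert Center ?N \<subseteq> verts G" "insert X ?M \<subseteq> verts G"
    "Km ` {..<m} \<subseteq> verts G" "Kl ` {..<l} \<subseteq> verts G"
    "Kms ` {..<m - s} \<subseteq> verts G" "Klt ` {..<l - t} \<subseteq> verts G"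
    using sub by (auto simp: G F_graph_def)
  have "e \<subseteq> verts G \<and> card e = 2" if "e \<in> edges G" for e
  proof -
    from that consider
      (K) A where "e \<in> complete_edges A"
        "A \<in> {Km ` {..<m}, Kl ` {..<l}, Kms ` {..<m - s}, Klt ` {..<l - t}}"
      | (N) "e \<in> join_edges Center ?N" | (M) "e \<in> join_edges X ?M"
      unfolding G F_graph_def sgraph.simps by blast
    then show ?thesis
    proof cases
      case K
      then have "A \<subseteq> verts G"
        using V by auto
      with complete[OF K(1)] show ?thesis by blast
    next
      case N
      have "e \<subseteq> insert Center ?N \<and> card e = 2"
        by (rule join[OF N]) auto
      with V(1) show ?thesis by blast
    next
      case M
      have "e \<subseteq> insert X ?M \<and> card e = 2"
        by (rule join[OF M]) auto
      with V(2) show ?thesis by blast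
    qed
  qed
  moreover have "finite (verts G)"
    by (simp add: G F_graph_def)
  ultimately show ?thesis
    by (simp add: finite_simple_graph_def)
qed

lemma finite_simple_graph_Fn_graphs:
  assumes "H \<in> Fn_graphs n l m t s"
  shows "finite_simple_graph H"
proof -
  from assms obtain G where H: "H = glue_at_center n G"
    and "\<forall>i\<in>{1..n}. G i \<in> F_graphs l m t s"
    unfolding Fn_graphs_def by blast
  then have G: "finite_simple_graph (G i)" if "i \<in> {1..n}" for i
    using that finite_simple_graph_F_graphs by blast
  have "inj (copy_vertex i)" for i
    by (auto simp: inj_def copy_vertex_def split: if_splits)
  then have card: "card (copy_vertex i ` e) = card e" for i e
    by (meson card_image inj_on_subset subset_UNIV)
  have "finite (verts H)"
    using G by (simp add: H glue_at_center_def finite_simple_graph_def)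
  moreover have "e \<subseteq> verts H \<and> card e = 2" if "e \<in> edges H" for e
  proof -
    from that obtain i e' where i: "i \<in> {1..n}" and e': "e' \<in> edges (G i)"
      and e: "e = copy_vertex i ` e'"
      by (auto simp: H glue_at_center_def)
    have "e' \<subseteq> verts (G i)" "card e' = 2"
      using G[OF i] e' by (auto simp: finite_simple_graph_def)
    then show ?thesis
      using i by (fastforce simp: e card H glue_at_center_def)
  qed
  ultimately show ?thesis
    by (simp add: finite_simple_graph_def)
qed

lemma F_graphs_nonempty:
  assumes "m \<le> l" "s \<le> m" "t + m \<le> l"
  shows "F_graphs l m t s \<noteq> {}"
proof -
  have "F_graph l m t s {..<s} {..<t} {..<l - t - m} {..<l - m} \<in> F_graphs l m t s"
    unfolding F_graphs_def using assms
    by (intro CollectI exI conjI refl) auto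
  then show ?thesis by blast
qed

lemma Fn_graphs_nonempty:
  assumes "m \<le> l" "s \<le> m" "t + m \<le> l"
  shows "Fn_graphs n l m t s \<noteq> {}"
  using F_graphs_nonempty[OF assms] by (auto simp: Fn_graphs_def)

end

theory Submission imports Defs
begin

text \<open>
  The independence polynomial of \<open>\<F>\<^sub>n(l,m,t,s)\<close> has a closed form, and the closed form
  is log-concave. Write \<open>p = (1 + m x)(1 + (m - s) x)(1 + (l - t) x)\<close>.

  Split the independent sets according to whether they contain the center. Those avoiding it
  are chosen independently in the \<open>n\<close> copies; in one copy without its center, splitting again
  on \<open>x\<^sub>i\<close>, the vertices \<open>x\<^sub>i\<close>, \<open>K\<^sub>m\<close> and \<open>K\<^sub>l\<close> contribute
  \<open>(1 + m x)(1 + l x) + x (1 + m x) = (1 + m x)(1 + (l + 1) x)\<close>, so that a copy contributes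
  \<open>p (1 + (l + 1) x)\<close>. If the center is taken, then what survives of a copy are cliques of orders
  \<open>m - s\<close>, \<open>l - t\<close> and \<open>(l - t) - (l - t - m) = m\<close>, contributing exactly \<open>p\<close>. Hence
  (lemma \<open>indep_poly_Fn_graph\<close>) the independence polynomial is
  \<open>p\<^sup>n ((1 + (l + 1) x)\<^sup>n + x)\<close>.

  Multiplication by \<open>1 + a x\<close> with \<open>a \<ge> 0\<close> preserves log-concavity, provided that this is
  stated in a form that excludes internal zeros (lemma \<open>log_concave_poly_mult_linear\<close>).
  It remains to see that adding \<open>x\<close> to \<open>(1 + a x)\<^sup>n\<close> with \<open>a = l + 1 \<ge> 1\<close> does not destroy log-concavity
  (lemma \<open>log_concave_poly_linear_power_plus_X\<close>). Only the coefficient of \<open>x\<close> changes, from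
  \<open>n a\<close> to \<open>n a + 1 \<le> (n + 1) a\<close>, and the binomial coefficients leave enough room for
  replacing \<open>n\<close> by \<open>n + 1\<close> there.
\<close>

section \<open>Counting independent sets by size\<close>

definition indep_in :: "'a set set \<Rightarrow> 'a set \<Rightarrow> 'a set set" where
  "indep_in E V = {S. S \<subseteq> V \<and> (\<forall>u\<in>S. \<forall>v\<in>S. {u, v} \<notin> E)}"

text \<open>
  This is the independence polynomial of the subgraph induced on \<open>V\<close>: edges leaving \<open>V\<close> have
  no effect, so that deleting vertices changes \<open>V\<close> only and the edge set stays fixed.
\<close>

definition indep_gen :: "'a set set \<Rightarrow> 'a set \<Rightarrow> int poly" where
  "indep_gen E V = (\<Sum>S\<in>indep_in E V. monom 1 (card S))"

lemma finite_indep_in: "finite V \<Longrightarrow> finite (indep_in E V)"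
  by (rule finite_subset[of _ "Pow V"]) (auto simp: indep_in_def)

text \<open>
  Truncating at the independence number loses nothing, since no larger independent set exists.
\<close>

lemma indep_poly_eq_indep_gen:
  assumes "finite (verts G)"
  shows "indep_poly G = indep_gen (edges G) (verts G)"
proof (rule poly_eqI)
  fix k
  have eq: "{S. indep_set G S} = indep_in (edges G) (verts G)"
    by (auto simp: indep_set_def indep_in_def)
  have fin: "finite (indep_in (edges G) (verts G))"
    using assms by (rule finite_indep_in)
  have "coeff (indep_gen (edges G) (verts G)) k =
      (\<Sum>S\<in>indep_in (edges G) (verts G). if card S = k then 1 else 0)"
    by (simp add: indep_gen_def coeff_sum)
  also have "\<dots> = int (card {S \<in> indep_in (edges G) (verts G). card S = k})"
    using fin by (simp add: sum.If_cases Int_def)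
  also have "{S \<in> indep_in (edges G) (verts G). card S = k} = {S. indep_set G S \<and> card S = k}"
    using eq by auto
  finally have gen: "coeff (indep_gen (edges G) (verts G)) k = int (indep_count G k)"
    by (simp add: indep_count_def)
  have "indep_count G k = 0" if "k > indep_number G"
  proof -
    have "card S \<noteq> k" if S: "indep_set G S" for S
    proof -
      have "card S \<le> indep_number G"
        unfolding indep_number_def eq using S eq fin by (intro Max_ge) auto
      with \<open>k > indep_number G\<close> show ?thesis by simp
    qed
    then have "{S. indep_set G S \<and> card S = k} = {}" by blast
    then show ?thesis by (simp only: indep_count_def card.empty)
  qed
  then show "coeff (indep_poly G) k = coeff (indep_gen (edges G) (verts G)) k"
    by (auto simp: gen coeff_indep_poly)
qed

lemma indep_gen_empty [simp]: "indep_gen E {} = 1"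
proof -
  have "indep_in E {} = {{}}" by (auto simp: indep_in_def)
  then show ?thesis by (simp add: indep_gen_def)
qed

text \<open>
  Vertex deletion: the independent sets containing \<open>v\<close> are the sets \<open>insert v T\<close> where \<open>T\<close> is
  independent and contains no neighbor of \<open>v\<close>.
\<close>

lemma indep_gen_insert:
  assumes "finite V" "v \<notin> V" "{v, v} \<notin> E"
  shows "indep_gen E (insert v V) =
    indep_gen E V + monom 1 1 * indep_gen E {u \<in> V. {v, u} \<notin> E}"
proof -
  let ?W = "{u \<in> V. {v, u} \<notin> E}"
  have split: "indep_in E (insert v V) = indep_in E V \<union> insert v ` indep_in E ?W"
  proof (rule set_eqI)
    fix S
    show "S \<in> indep_in E (insert v V) \<longleftrightarrow> S \<in> indep_in E V \<union> insert v ` indep_in E ?W"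
    proof (cases "v \<in> S")
      case True
      then obtain T where S: "S = insert v T" "v \<notin> T" by (meson Set.set_insert)
      have sym: "{u, v} = {v, u}" for u by blast
      have "S \<in> indep_in E (insert v V) \<longleftrightarrow> T \<in> indep_in E ?W"
        using S assms(2,3) by (auto simp: indep_in_def sym)
      moreover have "S \<in> insert v ` indep_in E ?W \<longleftrightarrow> T \<in> indep_in E ?W"
      proof
        assume "S \<in> insert v ` indep_in E ?W"
        then obtain T' where T': "T' \<in> indep_in E ?W" "S = insert v T'" by blast
        then have "v \<notin> T'" using assms(2) by (auto simp: indep_in_def)
        then have "T = T'" using S T'(2) by (simp add: insert_ident)
        with T'(1) show "T \<in> indep_in E ?W" by simp
      qed (simp add: S(1))
      moreover have "S \<notin> indep_in E V" using True assms(2) by (auto simp: indep_in_def)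
      ultimately show ?thesis by blast
    next
      case False
      then show ?thesis by (auto simp: indep_in_def)
    qed
  qed
  have notin: "v \<notin> S" if "S \<in> indep_in E ?W" for S
    using that assms(2) by (auto simp: indep_in_def)
  have inj: "inj_on (insert v) (indep_in E ?W)"
    using notin by (auto simp: inj_on_def dest: insert_ident)
  have "(\<Sum>S\<in>insert v ` indep_in E ?W. monom (1::int) (card S)) =
      (\<Sum>S\<in>indep_in E ?W. monom 1 1 * monom 1 (card S))"
  proof (subst sum.reindex[OF inj], rule sum.cong)
    fix S assume S: "S \<in> indep_in E ?W"
    then have "finite S" using assms(1) by (auto simp: indep_in_def intro: finite_subset)
    then show "((\<lambda>S. monom (1::int) (card S)) \<circ> insert v) S = monom 1 1 * monom 1 (card S)"
      using notin[OF S] by (simp add: mult_monom)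
  qed simp
  moreover have "indep_in E V \<inter> insert v ` indep_in E ?W = {}"
    using assms(2) by (auto simp: indep_in_def)
  ultimately show ?thesis
    unfolding indep_gen_def split
    using assms(1) by (simp add: sum.union_disjoint finite_indep_in sum_distrib_left)
qed

text \<open>
  An independent set of a disjoint union without cross edges is a pair of independent sets of
  the parts, and sizes add.
\<close>

lemma indep_gen_union:
  assumes "finite V" "finite W" "V \<inter> W = {}"
    and nonadj: "\<And>v w. v \<in> V \<Longrightarrow> w \<in> W \<Longrightarrow> {v, w} \<notin> E"
  shows "indep_gen E (V \<union> W) = indep_gen E V * indep_gen E W"
proof -
  have nonadj': "{w, v} \<notin> E" if "v \<in> V" "w \<in> W" for v w
    using nonadj[OF that] by (simp add: insert_commute)
  have "indep_gen E V * indep_gen E W =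
      (\<Sum>(A, B)\<in>indep_in E V \<times> indep_in E W. monom 1 (card A + card B))"
    by (simp add: indep_gen_def sum_product sum.cartesian_product mult_monom)
  also have "\<dots> = indep_gen E (V \<union> W)"
    unfolding indep_gen_def
  proof (rule sum.reindex_bij_witness[where i = "\<lambda>S. (S \<inter> V, S \<inter> W)" and j = "\<lambda>(A, B). A \<union> B"])
    fix p assume p: "p \<in> indep_in E V \<times> indep_in E W"
    then obtain A B where AB: "p = (A, B)" "A \<in> indep_in E V" "B \<in> indep_in E W" by blast
    then have sub: "A \<subseteq> V" "B \<subseteq> W" by (auto simp: indep_in_def)
    show "((case p of (A, B) \<Rightarrow> A \<union> B) \<inter> V, (case p of (A, B) \<Rightarrow> A \<union> B) \<inter> W) = p"
      using sub assms(3) AB(1) by auto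
    show "(case p of (A, B) \<Rightarrow> A \<union> B) \<in> indep_in E (V \<union> W)"
      using AB nonadj[OF subsetD[OF sub(1)] subsetD[OF sub(2)]]
        nonadj'[OF subsetD[OF sub(1)] subsetD[OF sub(2)]]
      by (auto simp: indep_in_def)
    have "card (A \<union> B) = card A + card B"
      using sub assms by (intro card_Un_disjoint) (auto intro: finite_subset)
    then show "monom (1::int) (card (case p of (A, B) \<Rightarrow> A \<union> B)) =
        (case p of (A, B) \<Rightarrow> monom 1 (card A + card B))"
      using AB(1) by simp
  qed (auto simp: indep_in_def)
  finally show ?thesis by simp
qed

text \<open>
  An independent set of a clique has at most one element.
\<close>

lemma indep_gen_clique:
  assumes "finite V"
    and "\<And>u v. u \<in> V \<Longrightarrow> v \<in> V \<Longrightarrow> {u, v} \<in> E \<longleftrightarrow> u \<noteq> v"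
  shows "indep_gen E V = [:1, int (card V):]"
  using assms
proof (induction V rule: finite_induct)
  case (insert v V)
  have none: "{u \<in> V. {v, u} \<notin> E} = {}"
    using insert.prems insert.hyps by auto
  have "indep_gen E (insert v V) = indep_gen E V + monom 1 1 * indep_gen E {u \<in> V. {v, u} \<notin> E}"
    using insert.hyps insert.prems[of v v] by (intro indep_gen_insert) auto
  also have "\<dots> = [:1, int (card V):] + monom 1 1"
    using insert.IH insert.prems by (simp add: none)
  also have "\<dots> = [:1, int (card (insert v V)):]"
    using insert.hyps by (simp add: monom_altdef)
  finally show ?case .
qed (simp add: one_pCons)

lemma indep_gen_UNION:
  assumes "finite I" "\<And>i. i \<in> I \<Longrightarrow> finite (V i)"
    and "\<And>i j. i \<in> I \<Longrightarrow> j \<in> I \<Longrightarrow> i \<noteq> j \<Longrightarrow> V i \<inter> V j = {}"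
    and "\<And>i j u v. i \<in> I \<Longrightarrow> j \<in> I \<Longrightarrow> i \<noteq> j \<Longrightarrow> u \<in> V i \<Longrightarrow> v \<in> V j \<Longrightarrow> {u, v} \<notin> E"
  shows "indep_gen E (\<Union>i\<in>I. V i) = (\<Prod>i\<in>I. indep_gen E (V i))"
  using assms
proof (induction I rule: finite_induct)
  case (insert i I)
  have "indep_gen E (V i \<union> (\<Union>j\<in>I. V j)) = indep_gen E (V i) * indep_gen E (\<Union>j\<in>I. V j)"
  proof (rule indep_gen_union)
    show "V i \<inter> (\<Union>j\<in>I. V j) = {}"
      using insert.hyps(2) insert.prems(2) by blast
    show "{u, v} \<notin> E" if "u \<in> V i" "v \<in> (\<Union>j\<in>I. V j)" for u v
      using that insert.hyps(2) insert.prems(3) by blast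
  qed (simp_all add: insert.hyps(1) insert.prems(1))
  moreover have "indep_gen E (\<Union>j\<in>I. V j) = (\<Prod>j\<in>I. indep_gen E (V j))"
  proof (rule insert.IH)
    show "finite (V j)" if "j \<in> I" for j
      using that by (intro insert.prems(1)) simp
    show "V j \<inter> V k = {}" if "j \<in> I" "k \<in> I" "j \<noteq> k" for j k
      using that by (intro insert.prems(2)) simp_all
    show "{u, v} \<notin> E" if "j \<in> I" "k \<in> I" "j \<noteq> k" "u \<in> V j" "v \<in> V k" for j k u v
      using that by (intro insert.prems(3)[of j k u v]) simp_all
  qed
  ultimately show ?case
    using insert.hyps by simp
qed simp

lemma indep_gen_image:
  assumes "inj_on f V"
    and "\<And>u v. u \<in> V \<Longrightarrow> v \<in> V \<Longrightarrow> {f u, f v} \<in> E' \<longleftrightarrow> {u, v} \<in> E"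
  shows "indep_gen E' (f ` V) = indep_gen E V"
proof -
  have inj: "inj_on ((`) f) (indep_in E V)"
    using inj_on_image_Pow[OF assms(1)] by (rule inj_on_subset) (auto simp: indep_in_def)
  have eq: "indep_in E' (f ` V) = (`) f ` indep_in E V"
  proof (rule set_eqI)
    fix T
    show "T \<in> indep_in E' (f ` V) \<longleftrightarrow> T \<in> (`) f ` indep_in E V"
    proof
      assume T: "T \<in> indep_in E' (f ` V)"
      then obtain S where "S \<subseteq> V" "T = f ` S"
        by (auto simp: indep_in_def subset_image_iff)
      then show "T \<in> (`) f ` indep_in E V"
        using T assms(2) by (auto simp: indep_in_def subset_iff intro!: imageI)
    next
      assume "T \<in> (`) f ` indep_in E V"
      then show "T \<in> indep_in E' (f ` V)"
        using assms(2) by (auto simp: indep_in_def subset_iff)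
    qed
  qed
  have "card (f ` S) = card S" if "S \<in> indep_in E V" for S
    using that assms(1) by (auto simp: indep_in_def intro!: card_image intro: inj_on_subset)
  then show ?thesis
    by (simp add: indep_gen_def eq sum.reindex[OF inj])
qed

section \<open>Graphs glued at the center\<close>

lemma copy_vertex_eq_iff:
  "copy_vertex i u = copy_vertex j v \<longleftrightarrow> u = v \<and> (u = Center \<or> i = j)"
  by (auto simp: copy_vertex_def)

text \<open>
  Gluing creates no edges between different copies. Since \<open>copy_vertex\<close> ignores its index at the
  center, taking \<open>u\<close> to be the center covers the edges at the common vertex, with \<open>j\<close> arbitrary.
\<close>

lemma glued_edge_iff:
  assumes simple: "\<And>k. k \<in> {1..n} \<Longrightarrow> finite_simple_graph (G k)"
    and "i \<in> {1..n}" "v \<noteq> Center"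
  shows "{copy_vertex j u, copy_vertex i v} \<in> edges (glue_at_center n G) \<longleftrightarrow>
    (u = Center \<or> i = j) \<and> {u, v} \<in> edges (G i)"
proof
  assume "{copy_vertex j u, copy_vertex i v} \<in> edges (glue_at_center n G)"
  then obtain k e where k: "k \<in> {1..n}" "e \<in> edges (G k)"
    and e: "{copy_vertex j u, copy_vertex i v} = copy_vertex k ` e"
    by (auto simp: glue_at_center_def)
  from simple[OF k(1)] k(2) obtain a b where "e = {a, b}"
    by (auto simp: finite_simple_graph_def card_2_iff)
  with e k(2) show "(u = Center \<or> i = j) \<and> {u, v} \<in> edges (G i)"
    using assms(3) by (auto simp: doubleton_eq_iff copy_vertex_eq_iff insert_commute)
next
  assume "(u = Center \<or> i = j) \<and> {u, v} \<in> edges (G i)"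
  then have "{copy_vertex j u, copy_vertex i v} = copy_vertex i ` {u, v}" "{u, v} \<in> edges (G i)"
    by (auto simp: copy_vertex_def)
  with assms(2) show "{copy_vertex j u, copy_vertex i v} \<in> edges (glue_at_center n G)"
    unfolding glue_at_center_def sgraph.simps by blast
qed

text \<open>
  Deletion of the common center: once it is removed, with or without its neighbors, the copies
  are disconnected from each other and their contributions multiply.
\<close>

lemma indep_poly_glue_at_center:
  assumes "n \<ge> 1"
    and simple: "\<And>i. i \<in> {1..n} \<Longrightarrow> finite_simple_graph (G i)"
    and center: "\<And>i. i \<in> {1..n} \<Longrightarrow> Center \<in> verts (G i)"
  shows "indep_poly (glue_at_center n G) =
    (\<Prod>i\<in>{1..n}. indep_gen (edges (G i)) (verts (G i) - {Center})) +
    monom 1 1 * (\<Prod>i\<in>{1..n}. indep_gen (edges (G i))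
      {v \<in> verts (G i) - {Center}. {Center, v} \<notin> edges (G i)})"
proof -
  let ?E = "edges (glue_at_center n G)"
  let ?V = "\<lambda>i. verts (G i) - {Center}"
  let ?U = "\<Union>i\<in>{1..n}. copy_vertex i ` ?V i"
  have fin: "finite (verts (G i))" if "i \<in> {1..n}" for i
    using simple[OF that] by (simp add: finite_simple_graph_def)
  have verts: "verts (glue_at_center n G) = insert None ?U"
  proof -
    have "copy_vertex i ` verts (G i) = insert None (copy_vertex i ` ?V i)" if "i \<in> {1..n}" for i
    proof -
      have "verts (G i) = insert Center (?V i)" using center[OF that] by blast
      then have "copy_vertex i ` verts (G i) = insert (copy_vertex i Center) (copy_vertex i ` ?V i)"
        by (metis image_insert)
      then show ?thesis by (simp add: copy_vertex_def)
    qed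
    then show ?thesis
      using assms(1) by (auto simp: glue_at_center_def)
  qed
  have copies: "indep_gen ?E (\<Union>i\<in>{1..n}. copy_vertex i ` W i) =
      (\<Prod>i\<in>{1..n}. indep_gen (edges (G i)) (W i))"
    if W: "\<And>i. i \<in> {1..n} \<Longrightarrow> W i \<subseteq> ?V i" for W
  proof -
    have "indep_gen ?E (\<Union>i\<in>{1..n}. copy_vertex i ` W i) =
        (\<Prod>i\<in>{1..n}. indep_gen ?E (copy_vertex i ` W i))"
    proof (rule indep_gen_UNION)
      fix i j u v
      assume ij: "i \<in> {1..n}" "j \<in> {1..n}" "i \<noteq> j"
      show "copy_vertex i ` W i \<inter> copy_vertex j ` W j = {}"
        using W[OF ij(1)] ij(3) by (auto simp: copy_vertex_eq_iff)
      assume "u \<in> copy_vertex i ` W i" "v \<in> copy_vertex j ` W j"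
      then obtain a b where "u = copy_vertex i a" "v = copy_vertex j b" "a \<noteq> Center" "b \<noteq> Center"
        using W[OF ij(1)] W[OF ij(2)] by blast
      then show "{u, v} \<notin> ?E"
        using glued_edge_iff[of n G j b i a, OF simple] ij by simp
    next
      fix i assume i: "i \<in> {1..n}"
      show "finite (copy_vertex i ` W i)"
        using finite_subset[OF W[OF i]] fin[OF i] by simp
    qed simp
    also have "\<dots> = (\<Prod>i\<in>{1..n}. indep_gen (edges (G i)) (W i))"
    proof (intro prod.cong refl indep_gen_image)
      fix i assume i: "i \<in> {1..n}"
      show "inj_on (copy_vertex i) (W i)" by (simp add: inj_on_def copy_vertex_eq_iff)
      fix u v assume "u \<in> W i" "v \<in> W i"
      then have "u \<noteq> Center" "v \<noteq> Center" using W[OF i] by auto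
      then show "{copy_vertex i u, copy_vertex i v} \<in> ?E \<longleftrightarrow> {u, v} \<in> edges (G i)"
        using glued_edge_iff[of n G i v i u, OF simple] i by simp
    qed
    finally show ?thesis .
  qed
  have nbrs: "{u \<in> ?U. {None, u} \<notin> ?E} =
      (\<Union>i\<in>{1..n}. copy_vertex i ` {v \<in> ?V i. {Center, v} \<notin> edges (G i)})"
  proof -
    have adj: "{None, copy_vertex i v} \<in> ?E \<longleftrightarrow> {Center, v} \<in> edges (G i)"
      if "i \<in> {1..n}" "v \<noteq> Center" for i v
      using glued_edge_iff[of n G i v 0 Center, OF simple] that by (simp add: copy_vertex_def)
    show ?thesis
    proof (intro equalityI subsetI)
      fix u assume "u \<in> {u \<in> ?U. {None, u} \<notin> ?E}"
      then obtain i v where "i \<in> {1..n}" "v \<in> ?V i" "u = copy_vertex i v"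
        "{None, copy_vertex i v} \<notin> ?E" by blast
      moreover from this have "{Center, v} \<notin> edges (G i)" using adj by blast
      ultimately show "u \<in> (\<Union>i\<in>{1..n}. copy_vertex i ` {v \<in> ?V i. {Center, v} \<notin> edges (G i)})"
        by blast
    next
      fix u assume "u \<in> (\<Union>i\<in>{1..n}. copy_vertex i ` {v \<in> ?V i. {Center, v} \<notin> edges (G i)})"
      then obtain i v where "i \<in> {1..n}" "v \<in> ?V i" "u = copy_vertex i v"
        "{Center, v} \<notin> edges (G i)" by blast
      moreover from this have "{None, copy_vertex i v} \<notin> ?E" using adj by blast
      ultimately show "u \<in> {u \<in> ?U. {None, u} \<notin> ?E}" by blast
    qed
  qed
  have loop: "{None, None} \<notin> ?E"
  proof
    assume "{None, None} \<in> ?E"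
    then obtain i e where i: "i \<in> {1..n}" "e \<in> edges (G i)" and e: "{None} = copy_vertex i ` e"
      by (auto simp: glue_at_center_def)
    then have "card e = 2" using simple[OF i(1)] by (auto simp: finite_simple_graph_def)
    moreover have "card (copy_vertex i ` e) = card e"
      by (intro card_image) (simp add: inj_on_def copy_vertex_eq_iff)
    ultimately show False by (simp flip: e)
  qed
  have "indep_poly (glue_at_center n G) = indep_gen ?E (insert None ?U)"
    using fin verts by (subst indep_poly_eq_indep_gen) auto
  also have "\<dots> = indep_gen ?E ?U + monom 1 1 * indep_gen ?E {u \<in> ?U. {None, u} \<notin> ?E}"
  proof (rule indep_gen_insert)
    show "finite ?U" using fin by simp
    show "None \<notin> ?U" by (auto simp: copy_vertex_def)
  qed (fact loop)
  also have "indep_gen ?E ?U = (\<Prod>i\<in>{1..n}. indep_gen (edges (G i)) (?V i))"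
    by (rule copies) (rule subset_refl)
  also have "indep_gen ?E {u \<in> ?U. {None, u} \<notin> ?E} =
      (\<Prod>i\<in>{1..n}. indep_gen (edges (G i)) {v \<in> ?V i. {Center, v} \<notin> edges (G i)})"
    unfolding nbrs by (rule copies) (rule Collect_restrict)
  finally show ?thesis .
qed

section \<open>The independence polynomial of a single copy\<close>

lemma complete_edges_iff: "{u, v} \<in> complete_edges A \<longleftrightarrow> u \<in> A \<and> v \<in> A \<and> u \<noteq> v"
  by (auto simp: complete_edges_def doubleton_eq_iff)

lemma join_edges_iff: "{u, v} \<in> join_edges w B \<longleftrightarrow> u = w \<and> v \<in> B \<or> v = w \<and> u \<in> B"
  by (auto simp: join_edges_def doubleton_eq_iff)

lemmas F_graph_edge_iff = F_graph_def complete_edges_iff join_edges_iff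

text \<open>
  Without \<open>c\<close> and \<open>x\<^sub>i\<close> the graph is a disjoint union of cliques. Arbitrary parts of the cliques
  are allowed, because taking \<open>c\<close> or \<open>x\<^sub>i\<close> into an independent set removes some of the vertices.
\<close>

lemma indep_gen_F_graph_cliques:
  assumes "A \<subseteq> {..<m}" "B \<subseteq> {..<l}" "C \<subseteq> {..<m - s}" "D \<subseteq> {..<l - t}"
  shows "indep_gen (edges (F_graph l m t s P Q R Y)) (Km ` A \<union> Kl ` B \<union> Kms ` C \<union> Klt ` D) =
    [:1, int (card A):] * [:1, int (card B):] * [:1, int (card C):] * [:1, int (card D):]"
proof -
  let ?E = "edges (F_graph l m t s P Q R Y)"
  have fin: "finite A" "finite B" "finite C" "finite D"
    using assms by (auto intro: finite_subset)
  have clique: "indep_gen ?E (f ` S) = [:1, int (card S):]"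
    if "finite S" "inj_on f S" "\<And>u v. u \<in> S \<Longrightarrow> v \<in> S \<Longrightarrow> {f u, f v} \<in> ?E \<longleftrightarrow> u \<noteq> v"
    for f :: "nat \<Rightarrow> fvertex" and S
  proof -
    have "indep_gen ?E (f ` S) = [:1, int (card (f ` S)):]"
    proof (rule indep_gen_clique)
      fix x y assume "x \<in> f ` S" "y \<in> f ` S"
      then obtain u v where "u \<in> S" "v \<in> S" "x = f u" "y = f v" by blast
      then show "{x, y} \<in> ?E \<longleftrightarrow> x \<noteq> y"
        using that(3) inj_on_eq_iff[OF that(2)] by metis
    qed (use that(1) in simp)
    then show ?thesis by (simp only: card_image[OF that(2)])
  qed
  have "indep_gen ?E (Km ` A \<union> Kl ` B \<union> Kms ` C \<union> Klt ` D) =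
     indep_gen ?E (Km ` A) * indep_gen ?E (Kl ` B) * indep_gen ?E (Kms ` C) * indep_gen ?E (Klt ` D)"
  proof -
    have "indep_gen ?E (Km ` A \<union> Kl ` B \<union> Kms ` C \<union> Klt ` D) =
        indep_gen ?E (Km ` A \<union> Kl ` B \<union> Kms ` C) * indep_gen ?E (Klt ` D)"
      by (rule indep_gen_union) (use fin in \<open>auto simp: F_graph_edge_iff\<close>)
    also have "indep_gen ?E (Km ` A \<union> Kl ` B \<union> Kms ` C) =
        indep_gen ?E (Km ` A \<union> Kl ` B) * indep_gen ?E (Kms ` C)"
      by (rule indep_gen_union) (use fin in \<open>auto simp: F_graph_edge_iff\<close>)
    also have "indep_gen ?E (Km ` A \<union> Kl ` B) = indep_gen ?E (Km ` A) * indep_gen ?E (Kl ` B)"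
      by (rule indep_gen_union) (use fin in \<open>auto simp: F_graph_edge_iff\<close>)
    finally show ?thesis .
  qed
  moreover have "indep_gen ?E (Km ` A) = [:1, int (card A):]"
    using fin assms by (intro clique) (auto simp: F_graph_edge_iff inj_on_def)
  moreover have "indep_gen ?E (Kl ` B) = [:1, int (card B):]"
    using fin assms by (intro clique) (auto simp: F_graph_edge_iff inj_on_def)
  moreover have "indep_gen ?E (Kms ` C) = [:1, int (card C):]"
    using fin assms by (intro clique) (auto simp: F_graph_edge_iff inj_on_def)
  moreover have "indep_gen ?E (Klt ` D) = [:1, int (card D):]"
    using fin assms by (intro clique) (auto simp: F_graph_edge_iff inj_on_def)
  ultimately show ?thesis by simp
qed

text \<open>
  Both polynomials share the factor \<open>p\<close>. Only the numbers of neighbors of \<open>c\<close> and \<open>x\<^sub>i\<close> in each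
  clique matter, which is why the result is the same for every choice of these neighbors.
\<close>

lemma indep_gen_F_graph:
  assumes "m \<le> l" "s \<le> m" "t + m \<le> l" and G: "G \<in> F_graphs l m t s"
  defines "p \<equiv> [:1, int m:] * [:1, int (m - s):] * [:1, int (l - t):]"
  shows indep_gen_F_graph_minus_center:
      "indep_gen (edges G) (verts G - {Center}) = p * [:1, int (l + 1):]"
    and indep_gen_F_graph_minus_center_nbhd:
      "indep_gen (edges G) {v \<in> verts G - {Center}. {Center, v} \<notin> edges G} = p"
proof -
  from G obtain P Q R Y where GF: "G = F_graph l m t s P Q R Y"
    and sub: "P \<subseteq> {..<m}" "Q \<subseteq> {..<l}" "R \<subseteq> {..<l - t}" "Y \<subseteq> {..<l}"
    and card: "card P = s" "card Q = t" "card R = l - t - m" "card Y = l - m"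
    unfolding F_graphs_def by blast
  have fin: "finite P" "finite Q" "finite R" "finite Y"
    using sub by (auto intro: finite_subset)
  let ?W = "Km ` {..<m} \<union> Kl ` {..<l} \<union> Kms ` {..<m - s} \<union> Klt ` {..<l - t}"
  have V: "verts G - {Center} = insert X ?W"
    by (auto simp: GF F_graph_def)
  have NX: "{u \<in> ?W. {X, u} \<notin> edges G} =
      Km ` {} \<union> Kl ` ({..<l} - Y) \<union> Kms ` {..<m - s} \<union> Klt ` {..<l - t}"
    by (auto simp: GF F_graph_edge_iff)
  have "indep_gen (edges G) (insert X ?W) =
      indep_gen (edges G) ?W + monom 1 1 * indep_gen (edges G) {u \<in> ?W. {X, u} \<notin> edges G}"
  proof (rule indep_gen_insert)
    show "{X, X} \<notin> edges G"
      using finite_simple_graph_F_graphs[OF G] by (auto simp: finite_simple_graph_def)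
  qed auto
  also have "indep_gen (edges G) ?W =
      [:1, int m:] * [:1, int l:] * [:1, int (m - s):] * [:1, int (l - t):]"
    unfolding GF by (subst indep_gen_F_graph_cliques) auto
  also have "indep_gen (edges G) {u \<in> ?W. {X, u} \<notin> edges G} =
      [:1, int m:] * [:1, int (m - s):] * [:1, int (l - t):]"
    unfolding NX unfolding GF using sub fin card assms(1)
    by (subst indep_gen_F_graph_cliques) (auto simp: card_Diff_subset)
  also have "[:1, int m:] * [:1, int l:] * [:1, int (m - s):] * [:1, int (l - t):] +
      monom 1 1 * ([:1, int m:] * [:1, int (m - s):] * [:1, int (l - t):]) =
      p * ([:1, int l:] + monom 1 1)"
    by (simp only: p_def algebra_simps)
  also have "[:1, int l:] + monom 1 1 = [:1, int (l + 1):]"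
    by (simp add: monom_altdef)
  finally show "indep_gen (edges G) (verts G - {Center}) = p * [:1, int (l + 1):]"
    by (simp only: V)
  have NC: "{v \<in> verts G - {Center}. {Center, v} \<notin> edges G} =
      Km ` ({..<m} - P) \<union> Kl ` ({..<l} - Q) \<union> Kms ` {} \<union> Klt ` ({..<l - t} - R)"
    unfolding V by (auto simp: GF F_graph_edge_iff)
  have "indep_gen (edges G) {v \<in> verts G - {Center}. {Center, v} \<notin> edges G} =
      [:1, int (m - s):] * [:1, int (l - t):] * [:1, int m:]"
    unfolding NC unfolding GF using sub fin card assms(3)
    by (subst indep_gen_F_graph_cliques) (auto simp: card_Diff_subset)
  then show "indep_gen (edges G) {v \<in> verts G - {Center}. {Center, v} \<notin> edges G} = p"
    by (simp only: p_def mult_ac)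
qed

lemma indep_poly_Fn_graph:
  assumes "n \<ge> 1" "m \<le> l" "s \<le> m" "t + m \<le> l" "H \<in> Fn_graphs n l m t s"
  shows "indep_poly H = ([:1, int m:] * [:1, int (m - s):] * [:1, int (l - t):]) ^ n *
    ([:1, int (l + 1):] ^ n + monom 1 1)"
proof -
  from assms(5) obtain G where H: "H = glue_at_center n G"
    and G: "\<And>i. i \<in> {1..n} \<Longrightarrow> G i \<in> F_graphs l m t s"
    unfolding Fn_graphs_def by blast
  have center: "Center \<in> verts (G i)" if "i \<in> {1..n}" for i
    using G[OF that] by (auto simp: F_graphs_def F_graph_def)
  let ?p = "[:1, int m:] * [:1, int (m - s):] * [:1, int (l - t):]"
  have "indep_poly H = (\<Prod>i\<in>{1..n}. indep_gen (edges (G i)) (verts (G i) - {Center})) +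
      monom 1 1 * (\<Prod>i\<in>{1..n}. indep_gen (edges (G i))
        {v \<in> verts (G i) - {Center}. {Center, v} \<notin> edges (G i)})"
    unfolding H using assms(1) finite_simple_graph_F_graphs[OF G] center
    by (rule indep_poly_glue_at_center)
  also have "(\<Prod>i\<in>{1..n}. indep_gen (edges (G i)) (verts (G i) - {Center})) =
      (\<Prod>i\<in>{1..n}. ?p * [:1, int (l + 1):])"
    using indep_gen_F_graph_minus_center[OF assms(2-4) G] by (rule prod.cong[OF refl])
  also have "(\<Prod>i\<in>{1..n}. indep_gen (edges (G i))
      {v \<in> verts (G i) - {Center}. {Center, v} \<notin> edges (G i)}) = (\<Prod>i\<in>{1..n}. ?p)"
    using indep_gen_F_graph_minus_center_nbhd[OF assms(2-4) G] by (rule prod.cong[OF refl])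
  also have "(\<Prod>i\<in>{1..n}. ?p * [:1, int (l + 1):]) + monom 1 1 * (\<Prod>i\<in>{1..n}. ?p) =
      ?p ^ n * ([:1, int (l + 1):] ^ n + monom 1 1)"
    by (simp only: prod_constant card_atLeastAtMost power_mult_distrib distrib_left diff_Suc_1
        mult.commute[of "monom 1 1"])
  finally show ?thesis .
qed

section \<open>Log-concave polynomials\<close>

text \<open>
  The usual log-concavity is the case \<open>j = i + 1\<close>. For positive coefficients it implies the
  inequality for all \<open>i \<le> j\<close>, which says that the ratios of consecutive coefficients decrease.
  In general the inequality for all \<open>i \<le> j\<close> also rules out sequences such as \<open>1, 0, 0, 1\<close> with
  internal zeros, and this makes it stable under multiplication by \<open>1 + a x\<close>.
\<close>

definition log_concave_poly :: "int poly \<Rightarrow> bool" where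
  "log_concave_poly p \<longleftrightarrow> (\<forall>i. 0 \<le> coeff p i) \<and>
     (\<forall>i j. i \<le> j \<longrightarrow> coeff p i * coeff p (j + 1) \<le> coeff p (i + 1) * coeff p j)"

lemma log_concave_poly_one: "log_concave_poly 1"
  by (auto simp: log_concave_poly_def coeff_1)

text \<open>
  Write \<open>p\<^sub>i\<close> for the coefficients of \<open>p\<close>, so that those of the product are
  \<open>p\<^sub>i + a p\<^bsub>i-1\<^esub>\<close>. Expanding both sides of the required inequality in powers of \<open>a\<close>, it holds
  for each power separately: the constant and the quadratic terms are instances of the
  hypothesis, and the linear terms share \<open>p\<^sub>i p\<^sub>j\<close> and leave
  \<open>p\<^bsub>i-1\<^esub> p\<^bsub>j+1\<^esub> \<le> p\<^bsub>i+1\<^esub> p\<^bsub>j-1\<^esub>\<close>, which follows by moving the two indices towards each other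
  twice.
\<close>

lemma log_concave_poly_mult_linear:
  assumes p: "log_concave_poly p" and "0 \<le> a"
  shows "log_concave_poly ([:1, a:] * p)"
proof -
  let ?q = "[:1, a:] * p"
  have nonneg: "0 \<le> coeff p i" for i using p by (simp add: log_concave_poly_def)
  have lc: "coeff p i * coeff p (Suc j) \<le> coeff p (Suc i) * coeff p j" if "i \<le> j" for i j
    using p that by (simp add: log_concave_poly_def)
  have q0: "coeff ?q 0 = coeff p 0" by simp
  have qS: "coeff ?q (Suc i) = coeff p (Suc i) + a * coeff p i" for i
    by simp
  have "coeff ?q i * coeff ?q (Suc j) \<le> coeff ?q (Suc i) * coeff ?q j" if "i \<le> j" for i j
  proof (cases j)
    case 0
    with that show ?thesis by simp
  next
    case j: (Suc j')
    show ?thesis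
    proof (cases i)
      case 0
      have "a * (coeff p 1 * coeff p j') \<ge> 0" "a * (a * (coeff p 0 * coeff p j')) \<ge> 0"
        using nonneg assms(2) by simp_all
      then show ?thesis
        using lc[of 0 "Suc j'"] unfolding 0 j q0 qS by (simp add: algebra_simps)
    next
      case i: (Suc i')
      have le: "i' \<le> j'" using that i j by simp
      \<comment> \<open>For \<open>i' = j'\<close> both sides agree, and a second step inwards would overshoot.\<close>
      have outer: "coeff p i' * coeff p (Suc (Suc j')) \<le> coeff p (Suc (Suc i')) * coeff p j'"
      proof (cases "i' = j'")
        case False
        have "coeff p i' * coeff p (Suc (Suc j')) \<le> coeff p (Suc i') * coeff p (Suc j')"
          using le by (intro lc) simp
        also have "\<dots> \<le> coeff p (Suc (Suc i')) * coeff p j'"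
          using le False by (intro lc) simp
        finally show ?thesis .
      qed (simp add: mult.commute)
      have "coeff p (Suc i') * coeff p (Suc (Suc j')) \<le> coeff p (Suc (Suc i')) * coeff p (Suc j')"
        using le by (intro lc) simp
      moreover have "a * (coeff p i' * coeff p (Suc (Suc j')))
          \<le> a * (coeff p (Suc (Suc i')) * coeff p j')"
        using outer assms(2) by (rule mult_left_mono)
      moreover have "(a * a) * (coeff p i' * coeff p (Suc j'))
          \<le> (a * a) * (coeff p (Suc i') * coeff p j')"
        using lc[OF le] assms(2) by (intro mult_left_mono) simp_all
      ultimately show ?thesis unfolding i j qS by (simp add: algebra_simps)
    qed
  qed
  moreover have "0 \<le> coeff ?q i" for i
    using nonneg assms(2) by (cases i) (simp_all add: qS)
  ultimately show ?thesis by (simp add: log_concave_poly_def del: mult_pCons_left)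
qed

lemma log_concave_poly_mult_linear_power:
  assumes "log_concave_poly p" "0 \<le> a"
  shows "log_concave_poly ([:1, a:] ^ n * p)"
proof (induction n)
  case (Suc n)
  then have "log_concave_poly ([:1, a:] * ([:1, a:] ^ n * p))"
    using assms(2) by (rule log_concave_poly_mult_linear)
  then show ?case by (simp only: power_Suc mult.assoc)
qed (simp add: assms)

lemma coeff_linear_power: "coeff ([:1, a:] ^ n) k = of_nat (n choose k) * (a::int) ^ k"
proof (induction n arbitrary: k)
  case 0
  then show ?case by (cases k) simp_all
next
  case (Suc n)
  then show ?case by (cases k) (simp_all add: algebra_simps)
qed

text \<open>
  After division by the ratio \<open>(n - j) / (j + 1)\<close> of consecutive binomial coefficients this becomes
  \<open>2 (n + 1) (n - j) \<le> (j + 1) n (n - 1)\<close>. The worst case is \<open>j = 2\<close>, where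
  \<open>2 (n + 1) (n - 2) \<le> 3 n (n - 1)\<close> holds.
\<close>

lemma choose_two_choose_ineq:
  assumes "2 \<le> j"
  shows "(n + 1) * (n choose (j + 1)) \<le> (n choose 2) * (n choose j)"
proof (cases "n \<le> j")
  case False
  then obtain d where d: "n = j + d" by (metis le_add_diff_inverse nat_le_linear)
  obtain e where e: "j = 2 + e" using assms le_Suc_ex by blast
  have absorb: "(j + 1) * (n choose (j + 1)) = d * (n choose j)"
    using binomial_absorb_comp[of n j] binomial_absorption[of j n] by (simp add: d mult.commute)
  have two: "2 * (n choose 2) = n * (n - 1)"
    using binomial_absorption[of 1 n] by (simp add: numeral_2_eq_2)
  have bound: "2 * (n + 1) * d \<le> (j + 1) * (n * (n - 1))"
    by (simp add: d e algebra_simps)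
  have "2 * (j + 1) * ((n + 1) * (n choose (j + 1))) = 2 * (n + 1) * ((j + 1) * (n choose (j + 1)))"
    by (simp only: mult_ac)
  also have "\<dots> = 2 * (n + 1) * d * (n choose j)"
    by (simp only: absorb mult.assoc)
  also have "\<dots> \<le> (j + 1) * (n * (n - 1)) * (n choose j)"
    using bound by (rule mult_right_mono) simp
  also have "\<dots> = 2 * (j + 1) * ((n choose 2) * (n choose j))"
    by (simp only: mult_ac flip: two)
  finally show ?thesis by (simp only: mult_le_cancel1) simp
qed (simp add: binomial_eq_0)

text \<open>
  Raising the linear coefficient can only violate an inequality in which it stands on the smaller
  side, that is, for \<open>i = 1\<close> and \<open>j \<ge> 2\<close>, as both sides agree for \<open>i = j\<close>. There it is bounded by \<open>(n + 1) a\<close>, and after cancelling the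
  powers of \<open>a\<close> the binomial inequality above remains.
\<close>

lemma log_concave_poly_linear_power_plus_X:
  assumes "1 \<le> a"
  shows "log_concave_poly ([:1, a:] ^ n + monom 1 1)"
proof -
  let ?h = "[:1, a:] ^ n"
  let ?g = "?h + monom 1 1"
  have h: "log_concave_poly ?h"
    using log_concave_poly_mult_linear_power[OF log_concave_poly_one, of a n] assms by simp
  have nonneg: "0 \<le> coeff ?h i" for i using h by (simp add: log_concave_poly_def)
  have lc: "coeff ?h i * coeff ?h (Suc j) \<le> coeff ?h (Suc i) * coeff ?h j" if "i \<le> j" for i j
    using h that by (simp add: log_concave_poly_def)
  have g: "coeff ?g i = coeff ?h i + (if i = 1 then 1 else 0)" for i
    by simp
  have "coeff ?g i * coeff ?g (Suc j) \<le> coeff ?g (Suc i) * coeff ?g j" if ij: "i \<le> j" for i j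
  proof -
    consider "i = j" | "i \<noteq> 1" "i < j" | "i = 1" "i < j"
      using ij by linarith
    then show ?thesis
    proof cases
      case 1
      then show ?thesis by (simp add: mult.commute)
    next
      case 2
      have "coeff ?g i * coeff ?g (Suc j) = coeff ?h i * coeff ?h (Suc j)"
        using 2 by (simp add: g)
      also have "\<dots> \<le> coeff ?h (Suc i) * coeff ?h j"
        using 2 by (intro lc) simp
      also have "\<dots> \<le> coeff ?g (Suc i) * coeff ?g j"
        using nonneg by (intro mult_mono) (simp_all add: g)
      finally show ?thesis .
    next
      case 3
      have "coeff ?h 1 + 1 \<le> (int n + 1) * a"
        using assms by (simp add: coeff_linear_power algebra_simps)
      then have "(coeff ?h 1 + 1) * coeff ?h (Suc j) \<le> (int n + 1) * a * coeff ?h (Suc j)"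
        using nonneg by (rule mult_right_mono)
      also have "\<dots> = int ((n + 1) * (n choose (j + 1))) * a ^ (j + 2)"
        by (simp add: coeff_linear_power algebra_simps)
      also have "\<dots> \<le> int ((n choose 2) * (n choose j)) * a ^ (j + 2)"
        using choose_two_choose_ineq[of j n] 3 assms
        by (intro mult_right_mono) (simp_all only: of_nat_le_iff zero_le_power)
      also have "\<dots> = coeff ?h 2 * coeff ?h j"
        by (simp only: coeff_linear_power power_add) simp
      finally show ?thesis
        using 3 by (simp add: g numeral_2_eq_2)
    qed
  qed
  moreover have "0 \<le> coeff ?g i" for i
    using nonneg by (simp add: g)
  ultimately show ?thesis by (simp add: log_concave_poly_def)
qed

lemma log_concave_poly_linear_factors:
  assumes "0 \<le> a" "0 \<le> b" "0 \<le> c" "log_concave_poly p"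
  shows "log_concave_poly (([:1, a:] * [:1, b:] * [:1, c:]) ^ n * p)"
  using assms
  by (simp only: power_mult_distrib mult.assoc log_concave_poly_mult_linear_power)

lemma indep_poly_log_concaveI:
  assumes "log_concave_poly (indep_poly G)"
  shows "indep_poly_log_concave G"
  unfolding indep_poly_log_concave_def
proof
  fix k assume "k \<in> {1..indep_number G - 1}"
  moreover have "coeff (indep_poly G) (k - 1) * coeff (indep_poly G) (k + 1)
      \<le> coeff (indep_poly G) (k - 1 + 1) * coeff (indep_poly G) k"
    using assms by (simp add: log_concave_poly_def)
  ultimately show "coeff (indep_poly G) (k - 1) * coeff (indep_poly G) (k + 1)
      \<le> (coeff (indep_poly G) k)\<^sup>2"
    by (simp add: power2_eq_square)
qed

theorem corollary3p1:
  fixes n l m t s :: nat and H :: "(nat \<times> fvertex) option sgraph"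
  assumes "n \<ge> 1"
    and "l \<ge> m" and "m \<ge> s" and "l \<ge> t + m"
    and "H \<in> Fn_graphs n l m t s"
  shows "(m = 1 \<or> m = s + 1 \<or> l = t + 1 \<longrightarrow> indep_poly_log_concave H) \<and>
         (l \<ge> 1 \<and> t = 0 \<longrightarrow> indep_poly_log_concave H)"
proof -
  have "log_concave_poly (indep_poly H)"
    unfolding indep_poly_Fn_graph[OF assms]
    by (intro log_concave_poly_linear_factors log_concave_poly_linear_power_plus_X) simp_all
  then show ?thesis
    by (simp add: indep_poly_log_concaveI)
qed

end
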